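(* Let $k\ge1$ be an integer, let $\mathcal{H}_{k+1}$ be the class of $(k+1)$-uniform hypergraphs, and let $\mathcal{H}\subseteq\mathcal{H}_{k+1}$ be a minor-closed subclass. Then there exists a unique map $U:\mathcal{H}\to\mathbb{Z}[x,y,\alpha,a,b]$ such that for every $H\in\mathcal{H}$ and every $e\in E(H)$, $$U(H)=\begin{cases}\alpha^{n},&\text{if }E(H)=\emptyset\text{ and }v(H)=n,\\ a^{k-\Delta(e)}x^{\Delta(e)}\,U(H\setminus e)+b^{k-m(e)}y^{m(e)}\,U(H/e),&\text{otherwise,}\end{cases}$$ where $\Delta(e)=\kappa(H\setminus e)-\kappa(H)$ and $m(e)=k+1-v(e)$. Moreover, for $H=(V,E)\in\mathcal{H}$, $$U(H;x,y,\alpha,a,b)=\alpha^{\kappa(H)}\,a^{k|E|-v(H)+\kappa(H)}\,b^{v(H)-\kappa(H)}\,T_{\mathrm{HG}}\!\left(H;\frac{\alpha x}{b}+1,\frac{y}{a}+1\right).$$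
   Context: A hypergraph is a pair $H=(V,E)$ where $V$ is a finite set and $E=E(H)$ is a finite multiset (parallel hyperedges are allowed and treated as distinct elements of $E$) of multisets of elements of $V$, called hyperedges. For $e\in E$, $d(e)$ is the size of $e$ counted with multiplicity and $v(e)$ is the number of distinct vertices in $e$; it is always assumed that $d(e)>1$. $H$ is $(k+1)$-uniform if $d(e)=k+1$ for all $e\in E$. Write $v(H)=|V|$. $\kappa(H)$ is the number of connected components of the bipartite incidence graph with vertex classes $V$ and $E$, in which $u\in V$ and $e\in E$ are joined by as many edges as the multiplicity of $u$ in $e$. For $A\subseteq E$ let $\kappa(A)=\kappa((V,A))$, $d(A)=\sum_{e\in A}d(e)$, and $|A|$ is the number of hyperedges in $A$. Hypergraph Tutte polynomial: $T_{\mathrm{HG}}(H;x,y)=\sum_{A\subseteq E}(x-1)^{\kappa(A)-\kappa(H)}(y-1)^{d(A)-|A|-v(H)+\kappa(A)}$. Deletion: $H\setminus e=(V,E\setminus\{e\})$. Contraction: $H/e=(V',E')$ with $V'=(V\setminus e)\cup\{v_e\}$ (all vertices occurring in $e$ are removed and one new vertex $v_e$ is added) and $E'=\{f':f\in E\setminus\{e\}\}$, where $f'$ is obtained from $f$ by replacing every occurrence (with multiplicity) of a vertex of $e$ by $v_e$; thus $d(f')=d(f)$ and uniformity is preserved. Minor-closed means closed under these deletions and contractions. The condition $U(H)=\alpha^n$ is imposed for every edgeless $H\in\mathcal{H}$ on $n$ vertices, and the recursion for every $H$ with $E(H)\ne\emptyset$ and every $e\in E(H)$. *)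

theory Defs
  imports "HOL-Computational_Algebra.Computational_Algebra" "HOL-Library.Multiset" "HOL-Library.FuncSet"
begin

datatype 'v hypergraph =
  Hypergraph (verts: "'v set") (hedges: "'v multiset multiset")

definition wf_hypergraph :: "'v hypergraph \<Rightarrow> bool" where
  "wf_hypergraph H \<longleftrightarrow>
     finite (verts H) \<and> (\<forall>e \<in># hedges H. set_mset e \<subseteq> verts H \<and> size e > 1)"

definition uniform :: "nat \<Rightarrow> 'v hypergraph \<Rightarrow> bool" where
  "uniform r H \<longleftrightarrow> (\<forall>e \<in># hedges H. size e = r)"

definition uniform_hypergraphs :: "nat \<Rightarrow> 'v hypergraph set" where
  "uniform_hypergraphs r = {H. wf_hypergraph H \<and> uniform r H}"

text \<open>The elements of a multiset, with equal ones kept apart as \<^term>\<open>(x, 0)\<close>,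
  \<^term>\<open>(x, 1)\<close>, ...: parallel hyperedges count as distinct, both as nodes of
  the incidence graph and when summing over subsets of the hyperedges.\<close>

definition copies :: "'a multiset \<Rightarrow> ('a \<times> nat) set" where
  "copies M = {(x, i). i < count M x}"

definition multiset_of_copies :: "('a \<times> nat) set \<Rightarrow> 'a multiset" where
  "multiset_of_copies A = image_mset fst (mset_set A)"

text \<open>Adjacency in the bipartite incidence graph. How many parallel edges join \<^term>\<open>u\<close>
  to \<^term>\<open>f\<close> (namely \<^term>\<open>count f u\<close>) has no influence on its connected components.\<close>

definition incidence :: "'v hypergraph \<Rightarrow> (('v + 'v multiset \<times> nat) \<times> ('v + 'v multiset \<times> nat)) set" where
  "incidence H = {(Inl u, Inr (f, i)) | u f i.
     u \<in> verts H \<and> (f, i) \<in> copies (hedges H) \<and> count f u > 0}"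

definition \<kappa> :: "'v hypergraph \<Rightarrow> nat" where
  "\<kappa> H = card ((verts H <+> copies (hedges H)) // (incidence H \<union> (incidence H)\<inverse>)\<^sup>*)"

definition total_size :: "'v multiset multiset \<Rightarrow> nat" where
  "total_size A = (\<Sum>e \<in># A. size e)"

text \<open>The exponents are integers, so no subtraction is truncated; for well-formed
  hypergraphs they are non-negative.\<close>

definition T_HG :: "'v hypergraph \<Rightarrow> 'a::field \<Rightarrow> 'a \<Rightarrow> 'a" where
  "T_HG H x y = (\<Sum>A \<in> Pow (copies (hedges H)).
     let B = multiset_of_copies A; kB = int (\<kappa> (Hypergraph (verts H) B)) in
       (x - 1) powi (kB - int (\<kappa> H)) *
       (y - 1) powi (int (total_size B) - int (size B) - int (card (verts H)) + kB))"

definition del_edge :: "'v hypergraph \<Rightarrow> 'v multiset \<Rightarrow> 'v hypergraph" where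
  "del_edge H e = Hypergraph (verts H) (hedges H - {#e#})"

text \<open>Contraction of \<^term>\<open>e\<close>, with \<^term>\<open>w\<close> as the new vertex.\<close>

definition contract_edge :: "'v hypergraph \<Rightarrow> 'v multiset \<Rightarrow> 'v \<Rightarrow> 'v hypergraph" where
  "contract_edge H e w = Hypergraph ((verts H - set_mset e) \<union> {w})
     (image_mset (image_mset (\<lambda>u. if u \<in># e then w else u)) (hedges H - {#e#}))"

text \<open>The name of the new vertex is supplied by an arbitrary function \<^term>\<open>new\<close>,
  constrained only by freshness.\<close>

definition fresh_on :: "'v hypergraph set \<Rightarrow> ('v hypergraph \<Rightarrow> 'v multiset \<Rightarrow> 'v) \<Rightarrow> bool" where
  "fresh_on \<H> new \<longleftrightarrow> (\<forall>H \<in> \<H>. \<forall>e \<in># hedges H. new H e \<notin> verts H)"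

definition minor_closed :: "('v hypergraph \<Rightarrow> 'v multiset \<Rightarrow> 'v) \<Rightarrow> 'v hypergraph set \<Rightarrow> bool" where
  "minor_closed new \<H> \<longleftrightarrow> (\<forall>H \<in> \<H>. \<forall>e \<in># hedges H.
     del_edge H e \<in> \<H> \<and> contract_edge H e (new H e) \<in> \<H>)"

text \<open>The ring of integer polynomials in x, y, alpha, a, b, by adjoining them successively in this order.\<close>

type_synonym zpoly = "int poly poly poly poly poly"

definition var_x :: zpoly where "var_x = [:[:[:[:[:0, 1:]:]:]:]:]"
definition var_y :: zpoly where "var_y = [:[:[:[:0, 1:]:]:]:]"
definition var_\<alpha> :: zpoly where "var_\<alpha> = [:[:[:0, 1:]:]:]"
definition var_a :: zpoly where "var_a = [:[:0, 1:]:]"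
definition var_b :: zpoly where "var_b = [:0, 1:]"

text \<open>The natural-number subtractions here and in the recursion below do not truncate:
  for a hyperedge e of a (k+1)-uniform hypergraph, removing e cannot decrease the number of
  components, it increases it by at most v(e) - 1, and v(e) lies between 1 and k+1.\<close>

definition \<Delta> :: "'v hypergraph \<Rightarrow> 'v multiset \<Rightarrow> nat" where
  "\<Delta> H e = \<kappa> (del_edge H e) - \<kappa> H"

definition m_edge :: "nat \<Rightarrow> 'v multiset \<Rightarrow> nat" where
  "m_edge k e = k + 1 - card (set_mset e)"

definition universal_recursion ::
  "('v hypergraph \<Rightarrow> 'v multiset \<Rightarrow> 'v) \<Rightarrow> nat \<Rightarrow> 'v hypergraph set \<Rightarrow> ('v hypergraph \<Rightarrow> zpoly) \<Rightarrow> bool" where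
  "universal_recursion new k \<H> U \<longleftrightarrow> (\<forall>H \<in> \<H>.
     (hedges H = {#} \<longrightarrow> U H = var_\<alpha> ^ card (verts H)) \<and>
     (\<forall>e \<in># hedges H.
        U H = var_a ^ (k - \<Delta> H e) * var_x ^ \<Delta> H e * U (del_edge H e)
            + var_b ^ (k - m_edge k e) * var_y ^ m_edge k e * U (contract_edge H e (new H e))))"

end

theory Submission
  imports Defs
begin

text \<open>Expanding the claimed formula over edge sets \<open>A\<close> gives terms
  \<open>\<alpha>^\<kappa>(A) x^(\<kappa>(A)-\<kappa>(H)) y^(k|A|-v(H)+\<kappa>(A)) a^(k|E|+\<kappa>(H)-k|A|-\<kappa>(A)) b^(v(H)-\<kappa>(A))\<close>.
  All exponents are non-negative because adding one hyperedge lowers \<open>\<kappa>\<close> by at most \<open>k\<close>, so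
  this sum is a polynomial. It satisfies the recursion: the sets \<open>A\<close> avoiding \<open>e\<close> contribute
  the deletion term, and those containing \<open>e\<close> the contraction term, since contracting \<open>e\<close>
  preserves the number of components. The recursion determines \<open>U\<close> by induction on the number
  of hyperedges.\<close>

section \<open>Connected components\<close>

lemma card_image_eq_if_same_fibres:
  assumes "\<And>x x'. x \<in> X \<Longrightarrow> x' \<in> X \<Longrightarrow> p x = p x' \<longleftrightarrow> q x = q x'"
  shows "card (p ` X) = card (q ` X)"
proof -
  have *: "q (inv_into X p (p x)) = q x" if "x \<in> X" for x
    using assms[of "inv_into X p (p x)" x] that by (simp add: f_inv_into_f inv_into_into)
  have "bij_betw (\<lambda>C. q (inv_into X p C)) (p ` X) (q ` X)"
    unfolding bij_betw_def
  proof
    show "inj_on (\<lambda>C. q (inv_into X p C)) (p ` X)"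
      by (rule inj_onI) (use * assms in auto)
    show "(\<lambda>C. q (inv_into X p C)) ` p ` X = q ` X"
      using * by (auto simp: image_image)
  qed
  then show ?thesis by (rule bij_betw_same_card)
qed

text \<open>The map \<open>g\<close> induces a bijection of classes: the equivalence in
  \<open>iff\<close> makes it well defined and injective, and \<open>surj\<close> makes it hit every
  class of \<open>Y\<close>, even where \<open>g\<close> misses elements. It serves twice: to
  discard the hyperedge nodes of the incidence graph, and to compare vertex classes before and after
  a contraction.\<close>

lemma card_quotient_cong:
  assumes r: "equiv UNIV r" and s: "equiv UNIV s"
    and "g ` X \<subseteq> Y"
    and surj: "\<And>y. y \<in> Y \<Longrightarrow> \<exists>x\<in>X. (y, g x) \<in> s"
    and iff: "\<And>x x'. x \<in> X \<Longrightarrow> x' \<in> X \<Longrightarrow> (x, x') \<in> r \<longleftrightarrow> (g x, g x') \<in> s"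
  shows "card (X // r) = card (Y // s)"
proof -
  have X: "X // r = (\<lambda>x. r `` {x}) ` X"
    by (auto simp: quotient_def)
  have "Y // s = (\<lambda>x. s `` {g x}) ` X"
  proof
    show "Y // s \<subseteq> (\<lambda>x. s `` {g x}) ` X"
    proof
      fix C assume "C \<in> Y // s"
      then obtain y where y: "y \<in> Y" "C = s `` {y}" by (auto simp: quotient_def)
      then obtain x where "x \<in> X" "(y, g x) \<in> s" using surj by blast
      with y show "C \<in> (\<lambda>x. s `` {g x}) ` X"
        using equiv_class_eq[OF s] by blast
    qed
    show "(\<lambda>x. s `` {g x}) ` X \<subseteq> Y // s"
      using \<open>g ` X \<subseteq> Y\<close> by (auto simp: quotient_def)
  qed
  then show ?thesis unfolding X
    using card_image_eq_if_same_fibres[of X "\<lambda>x. r `` {x}" "\<lambda>x. s `` {g x}"] iff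
    by (simp add: eq_equiv_class_iff[OF r] eq_equiv_class_iff[OF s])
qed

lemma equiv_rtrancl_if_sym:
  assumes "sym r"
  shows "equiv UNIV (r\<^sup>*)"
  using assms by (simp add: equiv_def refl_rtrancl sym_rtrancl trans_rtrancl)

text \<open>Two steps through a hyperedge node of the incidence graph, compressed into one step
  between vertices. A set of hyperedges suffices here, since parallel copies do not change
  connectivity.\<close>

definition co_edge :: "'v multiset set \<Rightarrow> ('v \<times> 'v) set" where
  "co_edge F = {(u, v). \<exists>f\<in>F. u \<in># f \<and> v \<in># f}"

lemma equiv_co_edge: "equiv UNIV ((co_edge F)\<^sup>*)"
  by (rule equiv_rtrancl_if_sym) (auto simp: co_edge_def sym_def)

lemma co_edge_mono: "F \<subseteq> G \<Longrightarrow> co_edge F \<subseteq> co_edge G"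
  by (auto simp: co_edge_def)

text \<open>Hyperedges are non-empty, so every component of the incidence graph contains a vertex,
  and components can be counted on vertices alone.\<close>

lemma \<kappa>_eq_card_quotient_co_edge:
  assumes wf: "wf_hypergraph H"
  shows "\<kappa> H = card (verts H // (co_edge (set_mset (hedges H)))\<^sup>*)"
proof -
  define S where "S = co_edge (set_mset (hedges H))"
  define I where "I = incidence H \<union> (incidence H)\<inverse>"
  have eI: "equiv UNIV (I\<^sup>*)"
    unfolding I_def by (rule equiv_rtrancl_if_sym) (auto simp: sym_def)
  have preserved: "(Inl u, Inl v) \<in> I\<^sup>*" if "(u, v) \<in> S\<^sup>*" for u v
    using that
  proof (induction rule: rtrancl_induct)
    case base
    show ?case by simp
  next
    case (step y z)
    then obtain f where f: "f \<in># hedges H" "y \<in># f" "z \<in># f"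
      by (auto simp: S_def co_edge_def)
    \<comment> \<open>Any copy of \<open>f\<close> would do as the intermediate node; copy 0 exists
      as soon as \<open>f\<close> occurs at all.\<close>
    then have "(f, 0) \<in> copies (hedges H)" "y \<in> verts H" "z \<in> verts H"
      using wf by (auto simp: copies_def wf_hypergraph_def)
    then have "(Inl y, Inr (f, 0)) \<in> I" "(Inr (f, 0), Inl z) \<in> I"
      using f by (auto simp: I_def incidence_def)
    with step.IH show ?case by (meson rtrancl.rtrancl_into_rtrancl)
  qed
  \<comment> \<open>Paths alternate between the two node types, so the invariant also has to speak
    about hyperedge nodes: on reaching one, all of its vertices are reachable from
    \<open>u\<close>.\<close>
  have converse: "case n of Inl v \<Rightarrow> (u, v) \<in> S\<^sup>* | Inr fi \<Rightarrow> \<forall>z. z \<in># fst fi \<longrightarrow> (u, z) \<in> S\<^sup>*"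
    if "(Inl u, n) \<in> I\<^sup>*" for u n
    using that
  proof (induction rule: rtrancl_induct)
    case base
    show ?case by simp
  next
    case (step n n')
    from step(2) consider v f i where "n = Inl v" "n' = Inr (f, i)" "f \<in># hedges H" "v \<in># f"
      | v f i where "n = Inr (f, i)" "n' = Inl v" "v \<in># f"
      by (fastforce simp: I_def incidence_def copies_def intro: count_inI)
    then show ?case
    proof cases
      case 1
      then have "(v, z) \<in> S" if "z \<in># f" for z
        using that by (auto simp: S_def co_edge_def)
      with 1 step.IH show ?thesis
        by (auto intro: rtrancl.rtrancl_into_rtrancl)
    next
      case 2
      with step.IH show ?thesis by auto
    qed
  qed
  have iff: "(u, v) \<in> S\<^sup>* \<longleftrightarrow> (Inl u, Inl v) \<in> I\<^sup>*" for u v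
    using preserved converse[of u "Inl v"] by auto
  have "card (verts H // S\<^sup>*) = card ((verts H <+> copies (hedges H)) // I\<^sup>*)"
  proof (rule card_quotient_cong[OF _ eI, where g = Inl])
    show "equiv UNIV (S\<^sup>*)" unfolding S_def by (rule equiv_co_edge)
    show "\<exists>x\<in>verts H. (n, Inl x) \<in> I\<^sup>*" if n: "n \<in> verts H <+> copies (hedges H)" for n
    proof (cases n)
      case (Inl u)
      with n show ?thesis by auto
    next
      case (Inr fi)
      obtain f i where fi: "fi = (f, i)" by fastforce
      with n Inr have "(f, i) \<in> copies (hedges H)" by auto
      moreover from this have f: "f \<in># hedges H"
        by (auto simp: copies_def intro: count_inI)
      moreover have "f \<noteq> {#}" using wf f by (auto simp: wf_hypergraph_def)
      then obtain u where "u \<in># f" by blast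
      moreover from this f have "u \<in> verts H" using wf by (auto simp: wf_hypergraph_def)
      ultimately have "(n, Inl u) \<in> I" "u \<in> verts H"
        by (auto simp: Inr fi I_def incidence_def)
      then show ?thesis by blast
    qed
  qed (use iff in auto)
  then show ?thesis by (simp add: \<kappa>_def S_def I_def)
qed

section \<open>The effect of adding hyperedges on the number of components\<close>

lemma wf_hypergraph_add_mset:
  "wf_hypergraph (Hypergraph V (add_mset e B)) \<longleftrightarrow>
     set_mset e \<subseteq> V \<and> size e > 1 \<and> wf_hypergraph (Hypergraph V B)"
  by (auto simp: wf_hypergraph_def)

lemma wf_hypergraph_subset_mset:
  "wf_hypergraph (Hypergraph V M) \<Longrightarrow> B \<subseteq># M \<Longrightarrow> wf_hypergraph (Hypergraph V B)"
  by (auto simp: wf_hypergraph_def dest: mset_subset_eqD)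

lemma uniform_subset_mset:
  "uniform r (Hypergraph V M) \<Longrightarrow> B \<subseteq># M \<Longrightarrow> uniform r (Hypergraph V B)"
  by (auto simp: uniform_def dest: mset_subset_eqD)

lemma \<kappa>_edgeless:
  assumes "finite V"
  shows "\<kappa> (Hypergraph V {#}) = card V"
proof -
  have "wf_hypergraph (Hypergraph V {#})" using assms by (simp add: wf_hypergraph_def)
  moreover have "V // Id = (\<lambda>v. {v}) ` V" by (auto simp: quotient_def)
  ultimately show ?thesis
    by (simp add: \<kappa>_eq_card_quotient_co_edge co_edge_def card_image)
qed

text \<open>Adding \<open>e\<close> fuses the components that meet \<open>e\<close> into one and
  leaves all others alone. At most \<open>card (set_mset e)\<close> components meet
  \<open>e\<close>, so at most one less than that number is lost.\<close>

lemma \<kappa>_add_edge: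
  assumes wf: "wf_hypergraph (Hypergraph V (add_mset e B))"
  shows "\<kappa> (Hypergraph V (add_mset e B)) \<le> \<kappa> (Hypergraph V B)"
    and "\<kappa> (Hypergraph V B) + 1 \<le> \<kappa> (Hypergraph V (add_mset e B)) + card (set_mset e)"
proof -
  define R where "R = (co_edge (set_mset B))\<^sup>*"
  define R' where "R' = (co_edge (set_mset (add_mset e B)))\<^sup>*"
  have wf': "wf_hypergraph (Hypergraph V B)" and fin: "finite V"
    using wf by (auto simp: wf_hypergraph_def)
  have \<kappa>: "\<kappa> (Hypergraph V B) = card (V // R)" "\<kappa> (Hypergraph V (add_mset e B)) = card (V // R')"
    using \<kappa>_eq_card_quotient_co_edge[OF wf] \<kappa>_eq_card_quotient_co_edge[OF wf']
    by (simp_all add: R_def R'_def)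
  have eq: "equiv UNIV R" and eq': "equiv UNIV R'"
    unfolding R_def R'_def by (rule equiv_co_edge)+
  have finq: "finite (V // R)" "finite (V // R')"
    using fin by (simp_all add: quotient_def)
  have sub: "R \<subseteq> R'"
    unfolding R_def R'_def by (intro rtrancl_mono co_edge_mono) auto
  \<comment> \<open>Every new class is the \<open>R'\<close>-saturation of an old one, so there are
    at most as many new classes as old ones.\<close>
  have "V // R' \<subseteq> (\<lambda>C. R' `` C) ` (V // R)"
  proof
    fix C assume "C \<in> V // R'"
    then obtain v where v: "v \<in> V" "C = R' `` {v}" by (auto simp: quotient_def)
    have "R' `` (R `` {v}) = R' `` {v}"
    proof
      show "R' `` (R `` {v}) \<subseteq> R' `` {v}"
        using sub eq' by (auto simp: equiv_def dest: transD)
      show "R' `` {v} \<subseteq> R' `` (R `` {v})"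
        using eq by (auto simp: equiv_def refl_on_def)
    qed
    with v show "C \<in> (\<lambda>C. R' `` C) ` (V // R)" by (auto simp: quotient_def)
  qed
  then show "\<kappa> (Hypergraph V (add_mset e B)) \<le> \<kappa> (Hypergraph V B)"
    unfolding \<kappa> using finq by (rule_tac surj_card_le) auto

  have "e \<noteq> {#}" using wf by (auto simp: wf_hypergraph_def)
  then obtain u0 where u0: "u0 \<in># e" by blast
  then have u0V: "u0 \<in> V" using wf by (auto simp: wf_hypergraph_def)
  \<comment> \<open>A path that starts in an old class disjoint from \<open>e\<close> never gets to
    use \<open>e\<close>.\<close>
  have avoid: "(u, v) \<in> R"
    if "(u, v) \<in> R'" and no: "\<forall>z\<in>#e. (u, z) \<notin> R" for u v
    using that(1) unfolding R'_def
  proof (induction rule: rtrancl_induct)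
    case base
    show ?case by (simp add: R_def)
  next
    case (step y z)
    from step.IH no have "y \<notin># e" by blast
    with step(2) have "(y, z) \<in> co_edge (set_mset B)" by (auto simp: co_edge_def)
    with step.IH show ?case unfolding R_def by (rule rtrancl_into_rtrancl)
  qed
  \<comment> \<open>An old class missing \<open>e\<close> survives as a new class different from the
    fused one, which is the class of \<open>u0\<close>; any other old class is the class of some
    vertex of \<open>e\<close>. Removing the fused class on the right is what yields the
    \<open>+ 1\<close> in the bound.\<close>
  have "V // R \<subseteq> (V // R' - {R' `` {u0}}) \<union> (\<lambda>z. R `` {z}) ` set_mset e"
  proof
    fix C assume "C \<in> V // R"
    then obtain u where u: "u \<in> V" "C = R `` {u}" by (auto simp: quotient_def)
    show "C \<in> (V // R' - {R' `` {u0}}) \<union> (\<lambda>z. R `` {z}) ` set_mset e"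
    proof (cases "\<exists>z\<in>#e. (u, z) \<in> R")
      case True
      then show ?thesis using u(2) equiv_class_eq[OF eq] by blast
    next
      case False
      then have "R' `` {u} = R `` {u}" using avoid sub by blast
      moreover have "(u, u0) \<notin> R'" using avoid False u0 by blast
      then have "R' `` {u} \<noteq> R' `` {u0}" using eq_equiv_class_iff[OF eq'] by simp
      ultimately show ?thesis using u by (auto simp: quotient_def)
    qed
  qed
  then have "card (V // R) \<le> card ((V // R' - {R' `` {u0}}) \<union> (\<lambda>z. R `` {z}) ` set_mset e)"
    using finq by (intro card_mono) auto
  also have "\<dots> \<le> card (V // R' - {R' `` {u0}}) + card (set_mset e)"
    by (rule order_trans[OF card_Un_le]) (simp add: card_image_le)
  finally have "card (V // R) \<le> card (V // R' - {R' `` {u0}}) + card (set_mset e)" .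
  moreover have "R' `` {u0} \<in> V // R'" using u0V by (auto simp: quotient_def)
  then have "card (V // R' - {R' `` {u0}}) + 1 = card (V // R')"
    using finq(2) by (metis Suc_eq_plus1 card_Suc_Diff1)
  ultimately show "\<kappa> (Hypergraph V B) + 1 \<le> \<kappa> (Hypergraph V (add_mset e B)) + card (set_mset e)"
    unfolding \<kappa> by linarith
qed

lemma card_set_mset_le_size: "card (set_mset e) \<le> size e"
  by (metis card_length mset_sorted_list_of_multiset set_mset_mset size_mset ex_mset)

text \<open>Iterates the bound for one hyperedge: with at most \<open>k + 1\<close> distinct
  vertices, each added hyperedge costs at most \<open>k\<close> components.\<close>

lemma \<kappa>_union_edges:
  assumes "wf_hypergraph (Hypergraph V (B + C))" "uniform (k + 1) (Hypergraph V (B + C))"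
  shows "\<kappa> (Hypergraph V (B + C)) \<le> \<kappa> (Hypergraph V B) \<and>
    \<kappa> (Hypergraph V B) \<le> \<kappa> (Hypergraph V (B + C)) + k * size C"
  using assms
proof (induction C)
  case empty
  show ?case by simp
next
  case (add e C)
  from add.prems have wf: "wf_hypergraph (Hypergraph V (add_mset e (B + C)))"
    and "uniform (k + 1) (Hypergraph V (B + C))" and "size e = k + 1"
    by (auto simp: uniform_def)
  moreover from wf have "wf_hypergraph (Hypergraph V (B + C))"
    by (simp add: wf_hypergraph_add_mset)
  ultimately show ?case
    using add.IH \<kappa>_add_edge[OF wf] card_set_mset_le_size[of e] by simp
qed

text \<open>In this order, the four inequalities say that the exponents of x, a, b and y in the term
  of \<open>B\<close> are non-negative. The first two compare \<open>B\<close> with all of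
  \<open>M\<close>, the last two compare \<open>B\<close> with the edgeless hypergraph.\<close>

lemma \<kappa>_bounds:
  assumes wf: "wf_hypergraph (Hypergraph V M)" and un: "uniform (k + 1) (Hypergraph V M)"
    and sub: "B \<subseteq># M"
  shows "\<kappa> (Hypergraph V M) \<le> \<kappa> (Hypergraph V B)"
    and "\<kappa> (Hypergraph V B) + k * size B \<le> \<kappa> (Hypergraph V M) + k * size M"
    and "\<kappa> (Hypergraph V B) \<le> card V"
    and "card V \<le> \<kappa> (Hypergraph V B) + k * size B"
proof -
  obtain C where M: "M = B + C" using sub by (auto simp: mset_subset_eq_exists_conv)
  show "\<kappa> (Hypergraph V M) \<le> \<kappa> (Hypergraph V B)"
    and "\<kappa> (Hypergraph V B) + k * size B \<le> \<kappa> (Hypergraph V M) + k * size M"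
    using \<kappa>_union_edges[of V B C k] wf un by (auto simp: M algebra_simps)
  have "finite V" using wf by (simp add: wf_hypergraph_def)
  then show "\<kappa> (Hypergraph V B) \<le> card V"
    and "card V \<le> \<kappa> (Hypergraph V B) + k * size B"
    using \<kappa>_union_edges[of V "{#}" B k] wf_hypergraph_subset_mset[OF wf sub]
      uniform_subset_mset[OF un sub] by (auto simp: \<kappa>_edgeless)
qed

section \<open>Components under contraction\<close>

definition merge :: "'v multiset \<Rightarrow> 'v \<Rightarrow> 'v \<Rightarrow> 'v" where
  "merge e w = (\<lambda>u. if u \<in># e then w else u)"

lemma wf_hypergraph_merge:
  assumes "wf_hypergraph (Hypergraph V B)"
  shows "wf_hypergraph (Hypergraph (V - set_mset e \<union> {w}) (image_mset (image_mset (merge e w)) B))"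
  using assms by (auto simp: wf_hypergraph_def merge_def)

text \<open>On \<open>V\<close>, \<open>merge e w\<close> identifies only vertices of
  \<open>e\<close>, and these are already connected through \<open>e\<close> itself. Hence it
  induces a bijection between the components before and after contraction.\<close>

lemma \<kappa>_contract:
  assumes wf: "wf_hypergraph (Hypergraph V (add_mset e B))" and w: "w \<notin> V"
  shows "\<kappa> (Hypergraph (V - set_mset e \<union> {w}) (image_mset (image_mset (merge e w)) B)) =
    \<kappa> (Hypergraph V (add_mset e B))"
proof -
  define V' where "V' = V - set_mset e \<union> {w}"
  define B' where "B' = image_mset (image_mset (merge e w)) B"
  define R where "R = co_edge (set_mset (add_mset e B))"
  define R' where "R' = co_edge (set_mset B')"
  have eV: "set_mset e \<subseteq> V" and "e \<noteq> {#}"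
    and BV: "\<And>f z. f \<in># B \<Longrightarrow> z \<in># f \<Longrightarrow> z \<in> V"
    and wfB: "wf_hypergraph (Hypergraph V B)"
    using wf by (auto simp: wf_hypergraph_def)
  have preserved: "(merge e w u, merge e w v) \<in> R'\<^sup>*" if "(u, v) \<in> R\<^sup>*" for u v
    using that
  proof (induction rule: rtrancl_induct)
    case base
    show ?case by simp
  next
    case (step y z)
    from step(2) consider "y \<in># e" "z \<in># e" | f where "f \<in># B" "y \<in># f" "z \<in># f"
      by (auto simp: R_def co_edge_def)
    then have "(merge e w y, merge e w z) \<in> R'\<^sup>*"
    proof cases
      case 1
      then show ?thesis by (simp add: merge_def)
    next
      case 2
      then have "(merge e w y, merge e w z) \<in> R'"
        by (fastforce simp: R'_def B'_def co_edge_def)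
      then show ?thesis by blast
    qed
    with step.IH show ?case by (rule rtrancl_trans)
  qed
  \<comment> \<open>Freshness of \<open>w\<close> enters here: a vertex of \<open>V\<close> is sent
    to \<open>w\<close> only if it lies in \<open>e\<close>.\<close>
  have same: "(u, v) \<in> R\<^sup>*" if "u \<in> V" "v \<in> V" "merge e w u = merge e w v" for u v
  proof (cases "u = v")
    case False
    with that w have "u \<in># e" "v \<in># e" by (auto simp: merge_def split: if_splits)
    then have "(u, v) \<in> R" by (auto simp: R_def co_edge_def)
    then show ?thesis by blast
  qed simp
  \<comment> \<open>Stated for all preimages of the endpoint \<open>q\<close>, because consecutive
    steps of a path in the contraction may lift to different vertices of \<open>e\<close>;
    \<open>same\<close> bridges the gap.\<close>
  have converse: "\<forall>v\<in>V. merge e w v = q \<longrightarrow> (u, v) \<in> R\<^sup>*"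
    if "(merge e w u, q) \<in> R'\<^sup>*" "u \<in> V" for u q
    using that(1)
  proof (induction rule: rtrancl_induct)
    case base
    show ?case using same that(2) by auto
  next
    case (step q q')
    then obtain f z z' where f: "f \<in># B" "z \<in># f" "z' \<in># f"
      and z: "merge e w z = q" "merge e w z' = q'"
      by (auto simp: R'_def B'_def co_edge_def)
    have "(u, z) \<in> R\<^sup>*" using step.IH z BV f by blast
    moreover have "(z, z') \<in> R" using f by (auto simp: R_def co_edge_def)
    ultimately have "(u, z') \<in> R\<^sup>*" by (rule rtrancl_into_rtrancl)
    moreover have "z' \<in> V" using BV f by blast
    ultimately show ?case using same[of z'] z by (metis rtrancl_trans)
  qed
  have "card (V // R\<^sup>*) = card (V' // R'\<^sup>*)"
  proof (rule card_quotient_cong)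
    show "equiv UNIV (R\<^sup>*)" "equiv UNIV (R'\<^sup>*)"
      unfolding R_def R'_def by (rule equiv_co_edge)+
    show "merge e w ` V \<subseteq> V'" by (auto simp: V'_def merge_def)
    show "\<exists>u\<in>V. (v, merge e w u) \<in> R'\<^sup>*" if v: "v \<in> V'" for v
    proof (cases "v = w")
      case True
      obtain u where "u \<in># e" using \<open>e \<noteq> {#}\<close> by blast
      then show ?thesis using True eV by (intro bexI[of _ u]) (auto simp: merge_def)
    next
      case False
      then show ?thesis using v by (intro bexI[of _ v]) (auto simp: merge_def V'_def)
    qed
    show "(u, v) \<in> R\<^sup>* \<longleftrightarrow> (merge e w u, merge e w v) \<in> R'\<^sup>*" if "u \<in> V" "v \<in> V" for u v
      using that preserved converse by blast
  qed
  moreover have "wf_hypergraph (Hypergraph V' B')"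
    unfolding V'_def B'_def using wfB by (rule wf_hypergraph_merge)
  ultimately show ?thesis
    using \<kappa>_eq_card_quotient_co_edge[OF wf] \<kappa>_eq_card_quotient_co_edge[of "Hypergraph V' B'"]
    by (simp add: R_def R'_def V'_def B'_def)
qed

section \<open>Sums over sub-multisets counted with multiplicity\<close>

text \<open>The shape of the sum in \<open>T_HG\<close>: it runs over sets of tagged copies while
  the summand sees only the underlying multiset. A sub-multiset thus counts as often as it can be
  chosen among the copies, a product of binomial coefficients.\<close>

definition sum_sub :: "('e multiset \<Rightarrow> 'a::comm_monoid_add) \<Rightarrow> 'e multiset \<Rightarrow> 'a" where
  "sum_sub F M = (\<Sum>A \<in> Pow (copies M). F (multiset_of_copies A))"

lemma copies_add_mset: "copies (add_mset e M) = insert (e, count M e) (copies M)"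
  by (auto simp: copies_def split: if_splits)

lemma finite_copies: "finite (copies M)"
  by (induction M) (simp_all add: copies_add_mset, simp add: copies_def)

lemma sum_sub_empty: "sum_sub F {#} = F {#}"
  by (simp add: sum_sub_def copies_def multiset_of_copies_def)

text \<open>Splits the sets of copies by whether they contain the new copy, which carries the tag
  \<open>count M e\<close>. This is the source of the deletion and contraction terms.\<close>

lemma sum_sub_add_mset:
  "sum_sub F (add_mset e M) = sum_sub F M + sum_sub (\<lambda>B. F (add_mset e B)) M"
proof -
  define c where "c = (e, count M e)"
  have c: "c \<notin> copies M" by (simp add: c_def copies_def)
  have "Pow (copies M) \<inter> insert c ` Pow (copies M) = {}" using c by auto
  moreover have "inj_on (insert c) (Pow (copies M))" using c by (intro inj_onI) auto
  moreover have "multiset_of_copies (insert c A) = add_mset e (multiset_of_copies A)"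
    if "A \<subseteq> copies M" for A
  proof -
    have "finite A" "c \<notin> A" using that c finite_subset[OF that finite_copies] by auto
    then show ?thesis by (simp add: multiset_of_copies_def) (simp add: c_def)
  qed
  ultimately show ?thesis
    by (simp add: sum_sub_def copies_add_mset flip: c_def)
      (simp add: Pow_insert sum.union_disjoint finite_copies sum.reindex)
qed

text \<open>Contraction may turn distinct hyperedges into parallel ones, which changes tags but not
  the number of copies. Induction with \<open>F\<close> arbitrary avoids an explicit bijection
  between the copies.\<close>

lemma sum_sub_image_mset: "sum_sub F (image_mset g M) = sum_sub (\<lambda>B. F (image_mset g B)) M"
  by (induction M arbitrary: F) (simp_all add: sum_sub_empty sum_sub_add_mset)

lemma multiset_of_copies_subset:
  assumes "A \<subseteq> copies M"
  shows "multiset_of_copies A \<subseteq># M"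
proof -
  have "image_mset fst (mset_set (copies M)) = M"
  proof (induction M)
    case empty
    show ?case by (simp add: copies_def)
  next
    case (add e M)
    have "(e, count M e) \<notin> copies M" by (simp add: copies_def)
    then show ?case using add.IH by (simp add: copies_add_mset finite_copies)
  qed
  moreover have "mset_set A \<subseteq># mset_set (copies M)"
    using assms by (simp add: finite_copies subset_imp_msubset_mset_set)
  ultimately show ?thesis
    unfolding multiset_of_copies_def by (metis image_mset_subseteq_mono)
qed

lemma sum_sub_cong:
  assumes "\<And>B. B \<subseteq># M \<Longrightarrow> F B = G B"
  shows "sum_sub F M = sum_sub G M"
  unfolding sum_sub_def using assms multiset_of_copies_subset by (intro sum.cong) auto

lemma sum_sub_mult_left:
  fixes c :: "'a::semiring_0"
  shows "sum_sub (\<lambda>B. c * F B) M = c * sum_sub F M"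
  by (simp add: sum_sub_def sum_distrib_left)

lemma to_fract_sum_sub:
  fixes F :: "'e multiset \<Rightarrow> 'a::idom"
  shows "to_fract (sum_sub F M) = sum_sub (\<lambda>B. to_fract (F B)) M"
proof -
  have "to_fract (sum f S) = (\<Sum>s\<in>S. to_fract (f s))" 
    for f :: "('e \<times> nat) set \<Rightarrow> 'a" and S
    by (induction S rule: infinite_finite_induct) simp_all
  then show ?thesis by (simp add: sum_sub_def)
qed

section \<open>The universal polynomial\<close>

text \<open>One term of the expanded formula. Each exponent is a single natural subtraction with its
  positive part collected first; by \<open>\<kappa>_bounds\<close> none truncates when
  \<open>B\<close> is a sub-multiset of the hyperedges of a well-formed,
  \<open>(k + 1)\<close>-uniform \<open>H\<close>.\<close>

definition state_weight :: "nat \<Rightarrow> 'v hypergraph \<Rightarrow> 'v multiset multiset \<Rightarrow> zpoly" where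
  "state_weight k H B = (let c = \<kappa> (Hypergraph (verts H) B) in
     var_\<alpha> ^ c * var_x ^ (c - \<kappa> H) * var_y ^ (k * size B + c - card (verts H)) *
     var_a ^ (k * size (hedges H) + \<kappa> H - (k * size B + c)) * var_b ^ (card (verts H) - c))"

definition universal_poly :: "nat \<Rightarrow> 'v hypergraph \<Rightarrow> zpoly" where
  "universal_poly k H = sum_sub (state_weight k H) (hedges H)"

lemma universal_poly_edgeless:
  assumes "finite V"
  shows "universal_poly k (Hypergraph V {#}) = var_\<alpha> ^ card V"
  using assms by (simp add: universal_poly_def sum_sub_empty state_weight_def \<kappa>_edgeless)

section \<open>Single terms under deletion and contraction\<close>

text \<open>Deleting \<open>e\<close> changes neither the vertex set nor \<open>B\<close>, so only
  the exponents of x and a change: the first drops by \<open>\<Delta> H e\<close> as \<kappa>(H)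
  grows by that amount, the second by \<open>k - \<Delta> H e\<close> as one hyperedge is lost as
  well.\<close>

lemma state_weight_delete:
  assumes wf: "wf_hypergraph (Hypergraph V (add_mset e N))"
    and un: "uniform (k + 1) (Hypergraph V (add_mset e N))" and B: "B \<subseteq># N"
  defines "H \<equiv> Hypergraph V (add_mset e N)"
  shows "state_weight k H B =
    var_a ^ (k - \<Delta> H e) * var_x ^ \<Delta> H e * state_weight k (Hypergraph V N) B"
proof -
  define c where "c = \<kappa> (Hypergraph V B)"
  define c1 where "c1 = \<kappa> (Hypergraph V N)"
  define c0 where "c0 = \<kappa> H"
  have wfN: "wf_hypergraph (Hypergraph V N)" and unN: "uniform (k + 1) (Hypergraph V N)"
    using wf un by (auto simp: wf_hypergraph_def uniform_def)
  \<comment> \<open>Equivalently, \<open>\<Delta> H e\<close> is a genuine difference and at most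
    \<open>k\<close>, so \<open>k - \<Delta> H e\<close> is exact.\<close>
  have 1: "c0 \<le> c1" "c1 \<le> c0 + k"
    using \<kappa>_bounds(1,2)[OF wf un, of N] by (auto simp: c0_def c1_def H_def)
  have 2: "c1 \<le> c" "c + k * size B \<le> c1 + k * size N"
    using \<kappa>_bounds(1,2)[OF wfN unN B] by (auto simp: c_def c1_def)
  have \<Delta>: "\<Delta> H e = c1 - c0"
    by (simp add: \<Delta>_def del_edge_def c1_def c0_def H_def)
  have x: "c - c0 = \<Delta> H e + (c - c1)" using 1 2 \<Delta> by simp
  have a: "k * size (add_mset e N) + c0 - (k * size B + c) =
      (k - \<Delta> H e) + (k * size N + c1 - (k * size B + c))"
    using 1 2 \<Delta> by simp
  have "state_weight k H B = var_\<alpha> ^ c * var_x ^ (c - c0) * var_y ^ (k * size B + c - card V) *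
     var_a ^ (k * size (add_mset e N) + c0 - (k * size B + c)) * var_b ^ (card V - c)"
    by (simp add: state_weight_def Let_def c_def c0_def H_def)
  also have "\<dots> = var_a ^ (k - \<Delta> H e) * var_x ^ \<Delta> H e *
     (var_\<alpha> ^ c * var_x ^ (c - c1) * var_y ^ (k * size B + c - card V) *
     var_a ^ (k * size N + c1 - (k * size B + c)) * var_b ^ (card V - c))"
    unfolding a x power_add by (simp only: mult_ac)
  finally show ?thesis by (simp add: state_weight_def Let_def c_def c1_def)
qed

text \<open>Contraction preserves both component counts and removes one hyperedge from
  \<open>H\<close> and from the chosen set, so the exponents of \<alpha>, x and a are unchanged. The
  vertex count drops by v(e) - 1 = k - m(e), which lowers the exponent of b by k - m(e) and that of
  y by k - (k - m(e)) = m(e).\<close>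

lemma state_weight_contract:
  assumes wf: "wf_hypergraph (Hypergraph V (add_mset e N))"
    and un: "uniform (k + 1) (Hypergraph V (add_mset e N))" and B: "B \<subseteq># N" and w: "w \<notin> V"
  defines "H \<equiv> Hypergraph V (add_mset e N)"
  shows "state_weight k H (add_mset e B) =
    var_b ^ (k - m_edge k e) * var_y ^ m_edge k e *
    state_weight k (contract_edge H e w) (image_mset (image_mset (merge e w)) B)"
proof -
  define V' where "V' = V - set_mset e \<union> {w}"
  define N' where "N' = image_mset (image_mset (merge e w)) N"
  define B' where "B' = image_mset (image_mset (merge e w)) B"
  define c where "c = \<kappa> (Hypergraph V (add_mset e B))"
  define c0 where "c0 = \<kappa> H"
  define m where "m = m_edge k e"
  have H': "contract_edge H e w = Hypergraph V' N'"
    by (simp add: contract_edge_def V'_def N'_def H_def merge_def)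
  have eV: "set_mset e \<subseteq> V" and fin: "finite V" and "e \<noteq> {#}"
    and sz: "size e = k + 1" and wfN: "wf_hypergraph (Hypergraph V N)"
    using wf un by (auto simp: wf_hypergraph_def uniform_def)
  have e1: "card (set_mset e) \<ge> 1"
    using \<open>e \<noteq> {#}\<close> by (simp add: Suc_leI card_gt_0_iff)
  have ek: "card (set_mset e) \<le> k + 1" using card_set_mset_le_size[of e] sz by simp
  have eV': "card (set_mset e) \<le> card V" using eV fin by (simp add: card_mono)
  have cV': "card V' = card V + 1 - card (set_mset e)"
    using w fin eV eV' by (simp add: V'_def card_Diff_subset)
  have wfN': "wf_hypergraph (Hypergraph V' N')"
    unfolding V'_def N'_def using wfN by (rule wf_hypergraph_merge)
  have unN': "uniform (k + 1) (Hypergraph V' N')"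
    using un by (auto simp: uniform_def N'_def)
  have BN': "B' \<subseteq># N'" unfolding B'_def N'_def using B by (rule image_mset_subseteq_mono)
  have wfB: "wf_hypergraph (Hypergraph V (add_mset e B))"
    using wf B by (rule_tac wf_hypergraph_subset_mset) auto
  have \<kappa>B': "\<kappa> (Hypergraph V' B') = c"
    unfolding V'_def B'_def c_def using wfB w by (rule \<kappa>_contract)
  have \<kappa>N': "\<kappa> (Hypergraph V' N') = c0"
    unfolding V'_def N'_def c0_def H_def using wf w by (rule \<kappa>_contract)
  \<comment> \<open>The bounds are taken in the contracted hypergraph, where they make the
    subtractions against \<open>card V'\<close> exact.\<close>
  have bd: "c \<le> card V'" "card V' \<le> c + k * size B"
    using \<kappa>_bounds(3,4)[OF wfN' unN' BN'] by (auto simp: \<kappa>B') (simp add: B'_def)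
  have m: "m = k + 1 - card (set_mset e)" by (simp add: m_def m_edge_def)
  have y: "k * size (add_mset e B) + c - card V = m + (k * size B + c - card V')"
    using bd e1 ek eV' by (simp add: m cV')
  have b: "card V - c = (k - m) + (card V' - c)"
    using bd e1 ek eV' by (simp add: m cV')
  have a: "k * size (add_mset e N) + c0 - (k * size (add_mset e B) + c) =
      k * size N + c0 - (k * size B + c)"
    by simp
  have "state_weight k H (add_mset e B) = var_\<alpha> ^ c * var_x ^ (c - c0) *
     var_y ^ (k * size (add_mset e B) + c - card V) *
     var_a ^ (k * size (add_mset e N) + c0 - (k * size (add_mset e B) + c)) * var_b ^ (card V - c)"
    by (simp add: state_weight_def Let_def c_def c0_def H_def)
  also have "\<dots> = var_b ^ (k - m) * var_y ^ m *
     (var_\<alpha> ^ c * var_x ^ (c - c0) * var_y ^ (k * size B + c - card V') *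
     var_a ^ (k * size N + c0 - (k * size B + c)) * var_b ^ (card V' - c))"
    unfolding a b y power_add by (simp only: mult_ac)
  also have "\<dots> = var_b ^ (k - m) * var_y ^ m * state_weight k (Hypergraph V' N') B'"
    by (simp add: state_weight_def Let_def \<kappa>B' \<kappa>N') (simp add: B'_def N'_def)
  finally show ?thesis by (simp add: H' m_def B'_def)
qed

text \<open>Sets of copies without the split-off copy of \<open>e\<close> give the deletion term;
  those with it give the contraction term, once their sum is transported along
  \<open>merge e w\<close> by \<open>sum_sub_image_mset\<close>.\<close>

lemma universal_poly_edge:
  assumes wf: "wf_hypergraph H" and un: "uniform (k + 1) H"
    and e: "e \<in># hedges H" and w: "w \<notin> verts H"
  shows "universal_poly k H =
    var_a ^ (k - \<Delta> H e) * var_x ^ \<Delta> H e * universal_poly k (del_edge H e) +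
    var_b ^ (k - m_edge k e) * var_y ^ m_edge k e * universal_poly k (contract_edge H e w)"
proof -
  define V where "V = verts H"
  obtain N where N: "hedges H = add_mset e N" using e by (meson multi_member_split)
  then have H: "H = Hypergraph V (add_mset e N)" by (cases H) (simp add: V_def)
  have del: "del_edge H e = Hypergraph V N" by (simp add: H del_edge_def)
  have con: "hedges (contract_edge H e w) = image_mset (image_mset (merge e w)) N"
    by (simp add: H contract_edge_def merge_def)
  have "universal_poly k H = sum_sub (state_weight k H) N +
      sum_sub (\<lambda>B. state_weight k H (add_mset e B)) N"
    by (simp add: universal_poly_def N sum_sub_add_mset)
  also have "sum_sub (state_weight k H) N =
      sum_sub (\<lambda>B. var_a ^ (k - \<Delta> H e) * var_x ^ \<Delta> H e * state_weight k (Hypergraph V N) B) N"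
    using state_weight_delete[of V e N k] wf un by (intro sum_sub_cong) (simp add: H)
  also have "\<dots> = var_a ^ (k - \<Delta> H e) * var_x ^ \<Delta> H e * universal_poly k (del_edge H e)"
    by (simp add: sum_sub_mult_left universal_poly_def del)
  also have "sum_sub (\<lambda>B. state_weight k H (add_mset e B)) N =
      sum_sub (\<lambda>B. var_b ^ (k - m_edge k e) * var_y ^ m_edge k e *
        state_weight k (contract_edge H e w) (image_mset (image_mset (merge e w)) B)) N"
    using state_weight_contract[of V e N k _ w] wf un w by (intro sum_sub_cong) (simp add: H)
  also have "\<dots> = var_b ^ (k - m_edge k e) * var_y ^ m_edge k e *
      universal_poly k (contract_edge H e w)"
    by (simp add: sum_sub_mult_left universal_poly_def con sum_sub_image_mset)
  finally show ?thesis .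
qed

section \<open>Comparison with the Tutte polynomial in the fraction field\<close>

lemma to_fract_power: "to_fract (p ^ n) = to_fract p ^ n"
  by (induction n) simp_all

text \<open>Collects the powers of \<alpha>, a and b so that x and y occur only in \<alpha>x/b and
  y/a. For the term of a set A, \<open>c\<close> is \<kappa>(H) and \<open>p\<close>,
  \<open>q\<close>, \<open>r\<close>, \<open>s\<close> are the exponents of x, y, a, b.\<close>

lemma monomial_substitution:
  fixes \<alpha> x y a b :: "'a::field"
  assumes "a \<noteq> 0" "b \<noteq> 0"
  shows "\<alpha> ^ (c + p) * x ^ p * y ^ q * a ^ r * b ^ s =
    \<alpha> ^ c * a ^ (r + q) * b ^ (s + p) * ((\<alpha> * x / b) ^ p * (y / a) ^ q)"
  using assms by (simp add: power_add power_divide power_mult_distrib)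

lemma total_size_uniform:
  "uniform r (Hypergraph V B) \<Longrightarrow> total_size B = r * size B"
  by (induction B) (auto simp: total_size_def uniform_def)

text \<open>The shifts by 1 in the arguments cancel those in \<open>T_HG\<close>. After the
  substitution the remaining powers of \<alpha>, a and b are the same for all terms and factor out
  of the sum.\<close>

lemma to_fract_universal_poly:
  assumes "wf_hypergraph H" "uniform (k + 1) H"
  shows "to_fract (universal_poly k H) =
    to_fract var_\<alpha> ^ \<kappa> H *
    to_fract var_a powi (int (k * size (hedges H)) - int (card (verts H)) + int (\<kappa> H)) *
    to_fract var_b powi (int (card (verts H)) - int (\<kappa> H)) *
    T_HG H (to_fract var_\<alpha> * to_fract var_x / to_fract var_b + 1) (to_fract var_y / to_fract var_a + 1)"
proof -
  obtain V M where H: "H = Hypergraph V M" by (cases H)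
  have wf: "wf_hypergraph (Hypergraph V M)" and un: "uniform (k + 1) (Hypergraph V M)"
    using assms by (simp_all add: H)
  define a b x y \<alpha> where "a = to_fract var_a" and "b = to_fract var_b" and "x = to_fract var_x"
    and "y = to_fract var_y" and "\<alpha> = to_fract var_\<alpha>"
  define v n c0 where "v = card V" and "n = size M" and "c0 = \<kappa> H"
  have nz: "a \<noteq> 0" "b \<noteq> 0" by (simp_all add: a_def b_def var_a_def var_b_def)
  define t where "t B = (let kB = int (\<kappa> (Hypergraph V B)) in
       (\<alpha> * x / b) powi (kB - int c0) *
       (y / a) powi (int (total_size B) - int (size B) - int v + kB))" for B
  have T: "T_HG H (\<alpha> * x / b + 1) (y / a + 1) = sum_sub t M"
    by (simp add: T_HG_def sum_sub_def t_def Let_def H c0_def v_def)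
  have "to_fract (state_weight k H B) =
      \<alpha> ^ c0 * a powi (int (k * n) - int v + int c0) * b powi (int v - int c0) * t B"
    if B: "B \<subseteq># M" for B
  proof -
    define c where "c = \<kappa> (Hypergraph V B)"
    define p q r s where "p = c - c0" and "q = k * size B + c - v"
      and "r = k * n + c0 - (k * size B + c)" and "s = v - c"
    have bd: "c0 \<le> c" "c + k * size B \<le> c0 + k * n" "c \<le> v" "v \<le> c + k * size B"
      using \<kappa>_bounds[OF wf un B] by (auto simp: c_def c0_def n_def v_def H)
    have ts: "total_size B = (k + 1) * size B"
      by (rule total_size_uniform[OF uniform_subset_mset[OF un B]])
    \<comment> \<open>The key cancellation: \<open>r + q\<close> and \<open>s + p\<close> no longer
      depend on \<open>B\<close>.\<close>
    have 1: "int (k * n) - int v + int c0 = int (r + q)" "int v - int c0 = int (s + p)"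
      "int c - int c0 = int p"
      using bd by (auto simp: p_def q_def r_def s_def)
    have 2: "int (total_size B) - int (size B) - int v + int c = int q"
      using bd by (auto simp: ts q_def)
    have c: "c = c0 + p" using bd by (simp add: p_def)
    have "to_fract (state_weight k H B) = \<alpha> ^ c * x ^ p * y ^ q * a ^ r * b ^ s"
      by (simp add: state_weight_def Let_def H to_fract_power c_def c0_def n_def v_def
          p_def q_def r_def s_def a_def b_def x_def y_def \<alpha>_def)
    also have "\<dots> = \<alpha> ^ c0 * a ^ (r + q) * b ^ (s + p) * ((\<alpha> * x / b) ^ p * (y / a) ^ q)"
      unfolding c using nz by (rule monomial_substitution)
    finally show ?thesis
      unfolding t_def Let_def c_def[symmetric] 1 2 power_int_of_nat .
  qed
  then have "to_fract (universal_poly k H) =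
      \<alpha> ^ c0 * a powi (int (k * n) - int v + int c0) * b powi (int v - int c0) * sum_sub t M"
    unfolding universal_poly_def to_fract_sum_sub sum_sub_mult_left[symmetric]
    unfolding H hypergraph.sel by (rule sum_sub_cong)
  then show ?thesis
    unfolding T[symmetric] by (simp add: H a_def b_def x_def y_def \<alpha>_def v_def n_def c0_def)
qed

section \<open>Uniqueness and existence of the solution\<close>

text \<open>Both minors have fewer hyperedges and stay in the class, and the fixed choice
  \<open>new\<close> makes both solutions refer to the same contraction. One hyperedge
  \<open>e\<close> is enough to determine the value.\<close>

lemma universal_recursion_unique:
  assumes mc: "minor_closed new \<H>"
    and U: "universal_recursion new k \<H> U" and W: "universal_recursion new k \<H> W"
    and "H \<in> \<H>"
  shows "U H = W H"
  using \<open>H \<in> \<H>\<close>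
proof (induction "size (hedges H)" arbitrary: H rule: less_induct)
  case less
  show ?case
  proof (cases "hedges H = {#}")
    case True
    then show ?thesis using U W less.prems by (simp add: universal_recursion_def)
  next
    case False
    then obtain e where e: "e \<in># hedges H" by blast
    let ?D = "del_edge H e" and ?C = "contract_edge H e (new H e)"
    have "?D \<in> \<H>" "?C \<in> \<H>" using mc less.prems e by (auto simp: minor_closed_def)
    moreover have "size (hedges ?D) < size (hedges H)" "size (hedges ?C) < size (hedges H)"
      using e by (auto simp: del_edge_def contract_edge_def size_Diff1_less)
    ultimately have "U ?D = W ?D" "U ?C = W ?C" using less.hyps by auto
    then show ?thesis using U W less.prems e by (simp add: universal_recursion_def)
  qed
qed

text \<open>Minor-closedness keeps both minors inside \<open>\<H>\<close>, where
  \<open>restrict\<close> leaves the values of \<open>universal_poly\<close> unchanged.\<close>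

lemma universal_recursion_universal_poly:
  assumes "\<H> \<subseteq> uniform_hypergraphs (k + 1)" "fresh_on \<H> new" "minor_closed new \<H>"
  shows "universal_recursion new k \<H> (restrict (universal_poly k) \<H>)"
  unfolding universal_recursion_def
proof (intro ballI conjI impI)
  fix H assume H: "H \<in> \<H>"
  then have wf: "wf_hypergraph H" and un: "uniform (k + 1) H"
    using assms(1) by (auto simp: uniform_hypergraphs_def)
  show "restrict (universal_poly k) \<H> H = var_\<alpha> ^ card (verts H)" if "hedges H = {#}"
    using that H wf universal_poly_edgeless[of "verts H" k]
    by (cases H) (auto simp: wf_hypergraph_def)
  fix e assume e: "e \<in># hedges H"
  have "new H e \<notin> verts H" using assms(2) H e by (auto simp: fresh_on_def)
  moreover have "del_edge H e \<in> \<H>" "contract_edge H e (new H e) \<in> \<H>"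
    using assms(3) H e by (auto simp: minor_closed_def)
  ultimately show "restrict (universal_poly k) \<H> H =
      var_a ^ (k - \<Delta> H e) * var_x ^ \<Delta> H e * restrict (universal_poly k) \<H> (del_edge H e) +
      var_b ^ (k - m_edge k e) * var_y ^ m_edge k e *
        restrict (universal_poly k) \<H> (contract_edge H e (new H e))"
    using universal_poly_edge[OF wf un e] H by simp
qed

theorem theorem4p5:
  fixes k :: nat
    and \<H> :: "'v hypergraph set"
    and new :: "'v hypergraph \<Rightarrow> 'v multiset \<Rightarrow> 'v"
  assumes "k \<ge> 1"
    and "\<H> \<subseteq> uniform_hypergraphs (k + 1)"
    and "fresh_on \<H> new"
    and "minor_closed new \<H>"
  shows "(\<exists>!U. U \<in> \<H> \<rightarrow>\<^sub>E UNIV \<and> universal_recursion new k \<H> U) \<and>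
    (\<forall>U. U \<in> \<H> \<rightarrow>\<^sub>E UNIV \<and> universal_recursion new k \<H> U \<longrightarrow>
      (\<forall>H \<in> \<H>. to_fract (U H) =
         to_fract var_\<alpha> ^ \<kappa> H *
         to_fract var_a powi (int (k * size (hedges H)) - int (card (verts H)) + int (\<kappa> H)) *
         to_fract var_b powi (int (card (verts H)) - int (\<kappa> H)) *
         T_HG H (to_fract var_\<alpha> * to_fract var_x / to_fract var_b + 1) (to_fract var_y / to_fract var_a + 1)))"
proof -
  let ?P = "restrict (universal_poly k) \<H>"
  have P: "universal_recursion new k \<H> ?P"
    using assms(2-4) by (rule universal_recursion_universal_poly)
  have eq: "U H = universal_poly k H" if "universal_recursion new k \<H> U" "H \<in> \<H>" for U H
    using universal_recursion_unique[OF assms(4) that(1) P that(2)] that(2) by simp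
  have "\<exists>!U. U \<in> \<H> \<rightarrow>\<^sub>E UNIV \<and> universal_recursion new k \<H> U"
  proof (rule ex1I[of _ ?P])
    show "?P \<in> \<H> \<rightarrow>\<^sub>E UNIV \<and> universal_recursion new k \<H> ?P" using P by auto
    show "U = ?P" if "U \<in> \<H> \<rightarrow>\<^sub>E UNIV \<and> universal_recursion new k \<H> U" for U
      \<comment> \<open>On \<open>\<H>\<close> the recursion fixes the values; outside it both
        functions are \<open>undefined\<close> by extensionality, so they agree as total
        functions.\<close>
      using that eq by (auto simp: fun_eq_iff PiE_def extensional_def restrict_def)
  qed
  then show ?thesis
  proof (intro conjI allI impI ballI)
    fix U H assume U: "U \<in> \<H> \<rightarrow>\<^sub>E UNIV \<and> universal_recursion new k \<H> U" and H: "H \<in> \<H>"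
    from H assms(2) have "wf_hypergraph H" "uniform (k + 1) H"
      by (auto simp: uniform_hypergraphs_def)
    from to_fract_universal_poly[OF this]
    show "to_fract (U H) =
         to_fract var_\<alpha> ^ \<kappa> H *
         to_fract var_a powi (int (k * size (hedges H)) - int (card (verts H)) + int (\<kappa> H)) *
         to_fract var_b powi (int (card (verts H)) - int (\<kappa> H)) *
         T_HG H (to_fract var_\<alpha> * to_fract var_x / to_fract var_b + 1) (to_fract var_y / to_fract var_a + 1)"
      unfolding eq[OF conjunct2[OF U] H] .
  qed
qed

end
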